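(* Let $r\ge 2$, let $\{(X_i,* )\}_{i=1}^m$ be a family of based (normal, path-connected) spaces and let $K$ be a simplicial complex with vertex set $[m]=\{1,\ldots,m\}$. Assume the following three conditions hold: (1) $\mathrm{TC}_r(X_i)=r\,\mathrm{cat}(X_i)$ for all $i$; (2) the family is LS-logarithmic: $\mathrm{cat}(X_{i_1}\times\cdots\times X_{i_k})=\mathrm{cat}(X_{i_1})+\cdots+\mathrm{cat}(X_{i_k})$ for any subcollection $X_{i_1},\ldots,X_{i_k}$ with pairwise distinct indices; (3) the family is $\mathrm{TC}_r$-logarithmic: $\mathrm{TC}_r(X_{i_1}\times\cdots\times X_{i_k})=\mathrm{TC}_r(X_{i_1})+\cdots+\mathrm{TC}_r(X_{i_k})$ for any subcollection $X_{i_1},\ldots,X_{i_k}$ with pairwise distinct indices. Then $$\mathrm{TC}_r(\underline{X}^K)=r\,\mathrm{cat}(\underline{X}^K)=\max_{\sigma=[i_1,\ldots,i_n]}\left\{\mathrm{TC}_r(X_{i_1})+\cdots+\mathrm{TC}_r(X_{i_n})\right\},$$ where the maximum is taken over all simplices $\sigma$ of $K$.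
   Context: All spaces are assumed to be normal; topological complexity is considered for path-connected spaces. For a fibration $p\colon E\to B$, the sectional category $\mathrm{secat}(p)$ is the smallest $n$ such that $B$ is covered by $n+1$ open sets on each of which $p$ admits a continuous local section (and $\infty$ if no such $n$ exists). The Lusternik–Schnirelmann category is $\mathrm{cat}(X)=\mathrm{secat}(PX\to X)$, where $PX$ is the space of based paths and the map takes a path to its endpoint. For $r\ge 2$, $\mathrm{TC}_r(X)=\mathrm{secat}(p_r)$, where $p_r\colon X^{[0,1]}\to X^r$ is $p_r(\alpha)=\left(\alpha(0),\alpha(\tfrac1{r-1}),\ldots,\alpha(\tfrac{r-2}{r-1}),\alpha(1)\right)$. The polyhedral product $\underline{X}^K$ is the subspace $\bigcup_{\sigma\in K}X^\sigma$ of $\prod_{i=1}^m X_i$, where $X^\sigma=\prod_{i=1}^m Y_i$ with $Y_i=X_i$ if $i\in\sigma$ and $Y_i=\{*\}$ if $i\notin\sigma$.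
   Formalization: The based spaces are additionally assumed well-pointed, i.e. each (X_i,* ) is an NDR pair; without this the claim fails, e.g. for two cones over the Hawaiian earring, whose wedge at the bad points is not contractible. *)

theory Defs
  imports "HOL-Analysis.Analysis"
begin

text \<open>Free paths \<open>[0,1] \<rightarrow> X\<close> with the compact-open topology. To have one HOL function for
  each path, paths are \<open>undefined\<close> outside \<open>{0..1}\<close>.\<close>

definition paths_in :: "'a topology \<Rightarrow> (real \<Rightarrow> 'a) set" where
  "paths_in X = {\<alpha> \<in> extensional {0..1}. pathin X \<alpha>}"

definition path_space :: "'a topology \<Rightarrow> (real \<Rightarrow> 'a) topology" where
  "path_space X = topology_generated_by
     {{\<alpha> \<in> paths_in X. \<alpha> ` C \<subseteq> U} | C U. C \<subseteq> {0..1} \<and> compact C \<and> openin X U}"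

lemma topspace_path_space: "topspace (path_space X) = paths_in X"
  unfolding path_space_def topology_generated_by_topspace
proof (intro equalityI subsetI)
  fix \<alpha> assume "\<alpha> \<in> paths_in X"
  then have "\<alpha> \<in> {\<alpha> \<in> paths_in X. \<alpha> ` {} \<subseteq> {}}" by simp
  then show "\<alpha> \<in> \<Union> {{\<alpha> \<in> paths_in X. \<alpha> ` C \<subseteq> U} | C U.
      C \<subseteq> {0..1} \<and> compact C \<and> openin X U}"
    by (intro UnionI[of "{\<alpha> \<in> paths_in X. \<alpha> ` {} \<subseteq> {}}"]) (auto intro!: exI[of _ "{}"])
qed auto

definition based_path_space :: "'a topology \<Rightarrow> 'a \<Rightarrow> (real \<Rightarrow> 'a) topology" where
  "based_path_space X b = subtopology (path_space X) {\<alpha>. \<alpha> 0 = b}"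

text \<open>The infimum of the empty set of extended naturals is \<open>\<infinity>\<close>.\<close>

definition secat :: "'e topology \<Rightarrow> 'b topology \<Rightarrow> ('e \<Rightarrow> 'b) \<Rightarrow> enat" where
  "secat E B p = Inf {enat n | n.
     \<exists>U :: nat \<Rightarrow> 'b set. topspace B = (\<Union>i\<le>n. U i) \<and>
       (\<forall>i\<le>n. openin B (U i) \<and>
          (\<exists>s. continuous_map (subtopology B (U i)) E s \<and> (\<forall>x\<in>U i. p (s x) = x)))}"

definition LS_cat :: "'a topology \<Rightarrow> 'a \<Rightarrow> enat" where
  "LS_cat X b = secat (based_path_space X b) X (\<lambda>\<alpha>. \<alpha> 1)"

text \<open>The coordinates of \<open>X\<^sup>r\<close> are numbered \<open>0, \<dots>, r - 1\<close>.\<close>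

definition TC :: "nat \<Rightarrow> 'a topology \<Rightarrow> enat" where
  "TC r X = secat (path_space X) (product_topology (\<lambda>_. X) {..<r})
     (\<lambda>\<alpha>. \<lambda>j\<in>{..<r}. \<alpha> (real j / (real r - 1)))"

text \<open>Abstract simplicial complexes with vertex set exactly \<open>V\<close>; the empty simplex is included.\<close>

definition simplicial_complex_on :: "'v set \<Rightarrow> 'v set set \<Rightarrow> bool" where
  "simplicial_complex_on V K \<longleftrightarrow>
     K \<subseteq> Pow V \<and> (\<forall>\<sigma>\<in>K. finite \<sigma>) \<and> {} \<in> K \<and> (\<forall>v\<in>V. {v} \<in> K) \<and>
     (\<forall>\<sigma>\<in>K. \<forall>\<tau>. \<tau> \<subseteq> \<sigma> \<longrightarrow> \<tau> \<in> K)"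

definition polyhedral_product ::
    "'v set \<Rightarrow> ('v \<Rightarrow> 'a topology) \<Rightarrow> ('v \<Rightarrow> 'a) \<Rightarrow> 'v set set \<Rightarrow> ('v \<Rightarrow> 'a) topology" where
  "polyhedral_product V X pt K = subtopology (product_topology X V)
     (\<Union>\<sigma>\<in>K. \<Pi>\<^sub>E i\<in>V. if i \<in> \<sigma> then topspace (X i) else {pt i})"

text \<open>\<open>(X, b)\<close> is well-pointed, i.e. \<open>(X, {b})\<close> is an NDR pair: \<open>u\<close> vanishes exactly at \<open>b\<close>, and
  a homotopy relative to \<open>b\<close> deforms the identity of \<open>X\<close> to a map \<open>g\<close> sending \<open>{u < 1}\<close> to \<open>b\<close>.
  Well-pointedness is the tacit convention for based spaces in the theorem about polyhedral
  products. It cannot be dropped there: for the cone \<open>C\<close> over the Hawaiian earring, based at the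
  bad point of its bottom, \<open>C\<close> and \<open>C \<times> C\<close> are contractible, but the wedge \<open>C \<or> C\<close> (the
  polyhedral product over two disjoint vertices) is Griffiths' twin cone, which is not simply
  connected.\<close>

definition well_pointed :: "'a topology \<Rightarrow> 'a \<Rightarrow> bool" where
  "well_pointed X b \<longleftrightarrow> b \<in> topspace X \<and>
     (\<exists>u g. continuous_map X euclideanreal u \<and>
        (\<forall>x\<in>topspace X. 0 \<le> u x \<and> (u x = 0 \<longleftrightarrow> x = b)) \<and>
        homotopic_with (\<lambda>f. f b = b) X X id g \<and>
        (\<forall>x\<in>topspace X. u x < 1 \<longrightarrow> g x = b))"

end

theory Submission
  imports Defs
begin

text \<open>
  Lower bounds: for a simplex \<open>\<sigma>\<close> the product of the \<open>X i\<close>, \<open>i \<in> \<sigma>\<close>, is a retract of the polyhedral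
  product, and neither \<open>cat\<close> nor \<open>TC\<close> increases under retracts.

  Upper bounds: well-pointedness allows to choose the categorical cover of each \<open>X i\<close> such that the
  base point lies in the member number 0 only and stays fixed under its contraction. Coordinatewise
  contractions of members \<open>J i\<close> then preserve the polyhedral product. Functions subordinate to the
  covers assign to each point an index \<open>J\<close> that vanishes at base point coordinates, so that
  \<open>\<Sum> J\<close> is at most the sum of the categories over some simplex; grouping by \<open>\<Sum> J\<close> gives the
  bound for \<open>cat\<close>, and the same with \<open>r\<close> points at a time gives the bound for \<open>TC\<close>, because \<open>r\<close>
  contractions to the base point concatenate to a path through \<open>r\<close> given points. Working with
  functions on the factors avoids any normality assumption on the products.
\<close>

subsection \<open>Spaces of paths\<close>

lemma openin_path_space_basic:
  assumes "C \<subseteq> {0..1}" "compact C" "openin X U"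
  shows "openin (path_space X) {\<alpha> \<in> paths_in X. \<alpha> ` C \<subseteq> U}"
  unfolding path_space_def by (rule topology_generated_by_Basis) (use assms in blast)

text \<open>Preimages need only be tested on the sets that generate the compact-open
  topology.\<close>

lemma continuous_map_into_path_space:
  assumes "\<And>y. y \<in> topspace Y \<Longrightarrow> f y \<in> paths_in X"
    and "\<And>C U. C \<subseteq> {0..1} \<Longrightarrow> compact C \<Longrightarrow> openin X U \<Longrightarrow>
           openin Y {y \<in> topspace Y. f y ` C \<subseteq> U}"
  shows "continuous_map Y (path_space X) f"
proof -
  have "f ` topspace Y \<subseteq> topspace (path_space X)"
    using assms(1) by (auto simp: topspace_path_space)
  moreover have "openin Y (f -` {\<alpha> \<in> paths_in X. \<alpha> ` C \<subseteq> U} \<inter> topspace Y)"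
    if "C \<subseteq> {0..1}" "compact C" "openin X U" for C U
  proof -
    have "f -` {\<alpha> \<in> paths_in X. \<alpha> ` C \<subseteq> U} \<inter> topspace Y = {y \<in> topspace Y. f y ` C \<subseteq> U}"
      using assms(1) by auto
    with assms(2)[OF that] show ?thesis by simp
  qed
  ultimately show ?thesis
    unfolding path_space_def topology_generated_by_topspace
    by (intro continuous_on_generated_topo) auto
qed

text \<open>The points \<open>y\<close> whose path leaves \<open>U\<close> somewhere on
  \<open>C\<close> form the projection of a closed subset of \<open>C \<times> Y\<close>, and
  projecting along a compact factor is a closed map.\<close>

lemma continuous_map_curry_path:
  assumes h: "continuous_map (prod_topology (top_of_set {0..1::real}) Y) X h"
  shows "continuous_map Y (path_space X) (\<lambda>y. \<lambda>t\<in>{0..1}. h (t, y))"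
proof (rule continuous_map_into_path_space)
  fix y assume y: "y \<in> topspace Y"
  have "continuous_map (top_of_set {0..1}) X (h \<circ> (\<lambda>t. (t, y)))"
    by (rule continuous_map_compose[OF _ h]) (use y in \<open>simp add: continuous_map_pairwise o_def\<close>)
  then have "continuous_map (top_of_set {0..1}) X (\<lambda>t\<in>{0..1}. h (t, y))"
    by (rule continuous_map_eq) auto
  then show "(\<lambda>t\<in>{0..1}. h (t, y)) \<in> paths_in X"
    by (simp add: paths_in_def pathin_def)
next
  fix C :: "real set" and U
  assume C: "C \<subseteq> {0..1}" "compact C" and U: "openin X U"
  have "continuous_map (prod_topology (top_of_set C) Y) X h"
    using continuous_map_from_subtopology[OF h, of "C \<times> topspace Y"] C
    by (simp add: prod_topology_subtopology(1) subtopology_subtopology Times_Int_Times Int_absorb1)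
  then have "closedin (prod_topology (top_of_set C) Y)
      {z \<in> topspace (prod_topology (top_of_set C) Y). h z \<in> topspace X - U}"
    using U by (intro closedin_continuous_map_preimage) auto
  moreover have "closed_map (prod_topology (top_of_set C) Y) Y snd"
    using C by (intro closed_map_snd) (simp add: compact_space_subtopology)
  ultimately have "closedin Y (snd ` {z \<in> topspace (prod_topology (top_of_set C) Y).
      h z \<in> topspace X - U})"
    by (auto simp: closed_map_def)
  moreover have "{y \<in> topspace Y. (\<lambda>t\<in>{0..1}. h (t, y)) ` C \<subseteq> U} =
      topspace Y - snd ` {z \<in> topspace (prod_topology (top_of_set C) Y). h z \<in> topspace X - U}"
    (is "?L = ?R")
  proof -
    have "h (t, y) \<in> topspace X" if "t \<in> C" "y \<in> topspace Y" for t y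
      using h C that by (auto simp: continuous_map_def Pi_iff)
    then show ?thesis
      using C by (fastforce simp: image_iff subset_iff)
  qed
  ultimately show "openin Y ?L" by (simp add: closedin_def)
qed

text \<open>Local compactness of the interval is the point: a compact neighbourhood \<open>C\<close>
  of \<open>t0\<close> that \<open>s y0\<close> maps into \<open>W\<close> gives a subbasic open set
  of paths around \<open>s y0\<close>, and all pairs near \<open>(t0, y0)\<close> are then evaluated
  into \<open>W\<close>.\<close>

lemma continuous_map_uncurry_path:
  assumes s: "continuous_map Y (path_space X) s"
  shows "continuous_map (prod_topology (top_of_set {0..1::real}) Y) X (\<lambda>(t, y). s y t)"
proof -
  have path: "s y \<in> paths_in X" if "y \<in> topspace Y" for y
    using s that by (auto simp: continuous_map_def topspace_path_space Pi_iff)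
  then have val: "s y t \<in> topspace X" if "y \<in> topspace Y" "t \<in> {0..1}" for y t
    using that by (fastforce simp: paths_in_def pathin_def continuous_map_def Pi_iff)
  have "\<exists>N. openin (prod_topology (top_of_set {0..1}) Y) N \<and> z \<in> N \<and>
      (\<forall>w\<in>N. (\<lambda>(t, y). s y t) w \<in> W)"
    if W: "openin X W" and z: "z \<in> topspace (prod_topology (top_of_set {0..1}) Y)"
      and zW: "(\<lambda>(t, y). s y t) z \<in> W" for W z
  proof -
    obtain t0 y0 where z0: "z = (t0, y0)" and t0: "t0 \<in> {0..1}" and y0: "y0 \<in> topspace Y"
      using z by auto
    have "continuous_map (top_of_set {0..1}) X (s y0)"
      using path[OF y0] by (simp add: paths_in_def pathin_def)
    from openin_continuous_map_preimage[OF this W]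
    have "openin (top_of_set {0..1}) {t \<in> {0..1}. s y0 t \<in> W}" by simp
    moreover have "t0 \<in> {t \<in> {0..1}. s y0 t \<in> W}" using t0 zW z0 by simp
    ultimately obtain e where e: "e > 0" "cball t0 e \<inter> {0..1} \<subseteq> {t \<in> {0..1}. s y0 t \<in> W}"
      by (meson openin_contains_cball)
    define C where "C = cball t0 e \<inter> {0..1}"
    have C: "C \<subseteq> {0..1}" "compact C" unfolding C_def by (auto intro: compact_Int)
    let ?B = "{\<alpha> \<in> paths_in X. \<alpha> ` C \<subseteq> W}"
    have "openin Y {y \<in> topspace Y. s y \<in> ?B}"
      by (rule openin_continuous_map_preimage[OF s openin_path_space_basic[OF C W]])
    moreover have "openin (top_of_set {0..1}) ({0..1} \<inter> ball t0 e)"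
      by (simp add: openin_open_Int)
    ultimately have "openin (prod_topology (top_of_set {0..1}) Y)
        (({0..1} \<inter> ball t0 e) \<times> {y \<in> topspace Y. s y \<in> ?B})"
      by (simp add: openin_prod_Times_iff)
    moreover have "y0 \<in> {y \<in> topspace Y. s y \<in> ?B}"
      using path[OF y0] y0 e(2) by (auto simp: C_def)
    moreover have "({0..1} \<inter> ball t0 e) \<subseteq> C" by (auto simp: C_def)
    ultimately show ?thesis
      using t0 e(1) z0 by (intro exI[of _ "({0..1} \<inter> ball t0 e) \<times> {y \<in> topspace Y. s y \<in> ?B}"]) auto
  qed
  then have "openin (prod_topology (top_of_set {0..1}) Y)
      {z \<in> topspace (prod_topology (top_of_set {0..1}) Y). (\<lambda>(t, y). s y t) z \<in> W}"
    if "openin X W" for W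
    using that
    by (subst openin_subopen) (smt (verit, best) mem_Collect_eq openin_subset subset_eq)
  then show ?thesis
    using val by (auto simp: continuous_map_def)
qed

lemma continuous_map_path_space_compose:
  assumes q: "continuous_map X Y q"
  shows "continuous_map (path_space X) (path_space Y) (\<lambda>\<alpha>. \<lambda>t\<in>{0..1}. q (\<alpha> t))"
proof -
  \<comment> \<open>Uncurrying the identity of \<open>path_space X\<close> shows that evaluation is
    continuous.\<close>
  have "continuous_map (prod_topology (top_of_set {0..1}) (path_space X)) Y
      (q \<circ> (\<lambda>(t, \<alpha>). id \<alpha> t))"
    by (intro continuous_map_compose[OF continuous_map_uncurry_path q] continuous_map_id)
  from continuous_map_curry_path[OF this] show ?thesis by simp
qed

subsection \<open>Sectional category\<close>

text \<open>The infimum of a nonempty set of extended naturals is attained, and a cover with fewer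
  members can be padded by repeating its last member.\<close>

lemma secat_le_enat_iff:
  "secat E B p \<le> enat n \<longleftrightarrow>
     (\<exists>U :: nat \<Rightarrow> 'b set. topspace B = (\<Union>i\<le>n. U i) \<and>
       (\<forall>i\<le>n. openin B (U i) \<and>
          (\<exists>s. continuous_map (subtopology B (U i)) E s \<and> (\<forall>x\<in>U i. p (s x) = x))))"
  (is "_ \<longleftrightarrow> ?cover n")
proof
  assume "?cover n"
  then show "secat E B p \<le> enat n"
    unfolding secat_def by (intro Inf_lower) blast
next
  assume le: "secat E B p \<le> enat n"
  let ?A = "{enat n | n. ?cover n}"
  \<comment> \<open>The infimum of the empty set would be \<infinity>, which exceeds
    \<open>enat n\<close>.\<close>
  have "?A \<noteq> {}" using le unfolding secat_def Inf_enat_def by (auto split: if_splits)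
  then have "Inf ?A \<in> ?A" unfolding Inf_enat_def by (metis (no_types, lifting) LeastI_ex ex_in_conv)
  then obtain k where k: "secat E B p = enat k" "?cover k"
    unfolding secat_def by auto
  then obtain U where U: "topspace B = (\<Union>i\<le>k. U i)" "\<forall>i\<le>k. openin B (U i) \<and>
          (\<exists>s. continuous_map (subtopology B (U i)) E s \<and> (\<forall>x\<in>U i. p (s x) = x))" by blast
  have "k \<le> n" using le k(1) by simp
  then have "(\<Union>i\<le>n. U (min i k)) = (\<Union>i\<le>k. U i)"
    by (force simp: min_def)
  then show "?cover n"
    using U by (intro exI[of _ "\<lambda>i. U (min i k)"]) auto
qed

text \<open>The cover is pulled back along \<open>f\<close>; a section \<open>s\<close> over
  \<open>U i\<close> becomes \<open>g \<circ> (s \<circ> f)\<close>, which \<open>comm\<close> and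
  \<open>hf\<close> show to be a section of \<open>p'\<close>.\<close>

lemma secat_retract_le:
  assumes f: "continuous_map B' B f" and g: "continuous_map E E' g"
    and comm: "\<And>e. e \<in> topspace E \<Longrightarrow> p' (g e) = h (p e)"
    and hf: "\<And>x. x \<in> topspace B' \<Longrightarrow> h (f x) = x"
  shows "secat E' B' p' \<le> secat E B p"
proof (cases "secat E B p")
  case (enat n)
  then obtain U where cov: "topspace B = (\<Union>i\<le>n. U i)"
    and U: "\<And>i. i \<le> n \<Longrightarrow> openin B (U i)"
      "\<And>i. i \<le> n \<Longrightarrow> \<exists>s. continuous_map (subtopology B (U i)) E s \<and> (\<forall>x\<in>U i. p (s x) = x)"
    using secat_le_enat_iff[of E B p n] by auto
  let ?V = "\<lambda>i. {x \<in> topspace B'. f x \<in> U i}"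
  have "topspace B' = (\<Union>i\<le>n. ?V i)"
    using cov f by (fastforce simp: continuous_map_def)
  moreover have "openin B' (?V i)" if "i \<le> n" for i
    by (rule openin_continuous_map_preimage[OF f U(1)[OF that]])
  moreover have "\<exists>s. continuous_map (subtopology B' (?V i)) E' s \<and> (\<forall>x\<in>?V i. p' (s x) = x)"
    if i: "i \<le> n" for i
  proof -
    obtain s where s: "continuous_map (subtopology B (U i)) E s" "\<And>x. x \<in> U i \<Longrightarrow> p (s x) = x"
      using U(2)[OF i] by blast
    have "continuous_map (subtopology B' (?V i)) (subtopology B (U i)) f"
      using f by (auto simp: continuous_map_in_subtopology intro: continuous_map_from_subtopology)
    then have "continuous_map (subtopology B' (?V i)) E' (g \<circ> (s \<circ> f))"
      by (intro continuous_map_compose[OF _ g] continuous_map_compose[OF _ s(1)])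
    moreover have "s (f x) \<in> topspace E" if "x \<in> ?V i" for x
      using continuous_map_funspace[OF s(1)] that openin_subset[OF U(1)[OF i]] by auto
    ultimately show ?thesis
      using comm s(2) hf by (intro exI[of _ "g \<circ> (s \<circ> f)"]) auto
  qed
  ultimately show ?thesis
    unfolding enat secat_le_enat_iff by blast
qed simp

text \<open>For \<open>J : A \<rightarrow> \<nat>\<close> let \<open>W J\<close> be the open set where every \<open>\<phi> a (J a)\<close> is positive and exceeds every
  \<open>\<phi> b l\<close> with \<open>l > J b\<close>. Distinct \<open>J\<close> with the same sum are incomparable, which makes their \<open>W J\<close>
  disjoint; hence the sections glue over the union of the \<open>W J\<close> of one sum, and there are at most
  \<open>N + 1\<close> sums to consider.\<close>

lemma secat_le_of_graded_functions:
  fixes \<phi> :: "'i \<Rightarrow> nat \<Rightarrow> 'b \<Rightarrow> real" and n :: "'i \<Rightarrow> nat"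
  assumes fin: "finite A"
    and cont: "\<And>a l. a \<in> A \<Longrightarrow> l \<le> n a \<Longrightarrow> continuous_map B euclideanreal (\<phi> a l)"
    and top_index: "\<And>y. y \<in> topspace B \<Longrightarrow> \<exists>J. sum J A \<le> N \<and>
      (\<forall>a\<in>A. J a \<le> n a \<and> \<phi> a (J a) y > 0 \<and> (\<forall>l. J a < l \<and> l \<le> n a \<longrightarrow> \<phi> a l y \<le> 0))"
    and sect: "\<And>J. (\<And>a. a \<in> A \<Longrightarrow> J a \<le> n a) \<Longrightarrow>
      \<exists>s. continuous_map (subtopology B {y \<in> topspace B. \<forall>a\<in>A. \<phi> a (J a) y > 0}) E s \<and>
        (\<forall>y\<in>topspace B. (\<forall>a\<in>A. \<phi> a (J a) y > 0) \<longrightarrow> p (s y) = y)"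
  shows "secat E B p \<le> enat N"
proof -
  \<comment> \<open>Members of \<open>Js k\<close> are \<open>undefined\<close> off
    \<open>A\<close>, so two of them are equal once they agree on \<open>A\<close>.\<close>
  define Js where "Js k = {J \<in> Pi\<^sub>E A (\<lambda>a. {..n a}). sum J A = k}" for k
  define W where "W J = {y \<in> topspace B. (\<forall>a\<in>A. \<phi> a (J a) y > 0) \<and>
      (\<forall>a\<in>A. \<forall>b\<in>A. \<forall>l\<in>{J b<..n b}. \<phi> a (J a) y > \<phi> b l y)}" for J
  have openW: "openin B (W J)" if "J \<in> Js k" for J k
  proof -
    have J: "J a \<le> n a" if "a \<in> A" for a using \<open>J \<in> Js k\<close> that by (auto simp: Js_def)
    have pos: "openin B {y \<in> topspace B. \<phi> a (J a) y > 0}" if "a \<in> A" for a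
      using openin_continuous_map_preimage[OF cont[OF that J[OF that]], of "{0<..}"] by simp
    have less: "openin B {y \<in> topspace B. \<phi> a (J a) y > \<phi> b l y}"
      if "a \<in> A" "b \<in> A" "l \<in> {J b<..n b}" for a b l
    proof -
      have "continuous_map B euclideanreal (\<lambda>y. \<phi> a (J a) y - \<phi> b l y)"
        using that J by (intro continuous_map_diff cont) auto
      from openin_continuous_map_preimage[OF this, of "{0<..}"] show ?thesis by simp
    qed
    \<comment> \<open>The explicit factors \<open>topspace B\<close> take care of intersections over
      an empty index set.\<close>
    have "W J = (topspace B \<inter> (\<Inter>a\<in>A. {y \<in> topspace B. \<phi> a (J a) y > 0})) \<inter>
        (topspace B \<inter> (\<Inter>(a, b, l)\<in>(SIGMA a:A. SIGMA b:A. {J b<..n b}).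
            {y \<in> topspace B. \<phi> a (J a) y > \<phi> b l y}))"
      unfolding W_def by auto
    also have "openin B \<dots>"
      using pos less fin by (intro openin_Int openin_Int_Inter) auto
    finally show ?thesis .
  qed
  have disj: "J = J'" if mem: "J \<in> Js k" "J' \<in> Js k" and yW: "y \<in> W J" "y \<in> W J'" for J J' k y
  proof (rule ccontr)
    assume ne: "J \<noteq> J'"
    \<comment> \<open>With equal sums, \<open>I' \<le> I\<close> on all of \<open>A\<close> forces
      equality, since a single strict inequality would make the sums differ.\<close>
    have lt: "\<exists>a\<in>A. I a < I' a" if "I \<in> Js k" "I' \<in> Js k" "I \<noteq> I'" for I I'
    proof (rule ccontr)
      assume "\<not> (\<exists>a\<in>A. I a < I' a)"
      then have ge: "I' a \<le> I a" if "a \<in> A" for a using that by force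
      have "I' a = I a" if "a \<in> A" for a
      proof (rule ccontr)
        assume "I' a \<noteq> I a"
        then have "sum I' A < sum I A"
          using ge that fin by (intro sum_strict_mono_ex1) force+
        with \<open>I \<in> Js k\<close> \<open>I' \<in> Js k\<close> show False by (simp add: Js_def)
      qed
      then have "I = I'"
        using that(1,2) by (intro PiE_ext[of I A "\<lambda>a. {..n a}" I']) (auto simp: Js_def)
      with that(3) show False by contradiction
    qed
    obtain a b where ab: "a \<in> A" "J a < J' a" "b \<in> A" "J' b < J b"
      using lt[OF mem] lt[OF mem(2,1)] ne by metis
    have "J' a \<le> n a" "J b \<le> n b" using mem ab by (auto simp: Js_def PiE_iff)
    \<comment> \<open>\<open>J' a\<close> is an index above \<open>J a\<close>, and
      \<open>J b\<close> is one above \<open>J' b\<close>; the dominance conditions of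
      \<open>W J\<close> and \<open>W J'\<close> therefore contradict each other.\<close>
    then have "\<phi> b (J b) y > \<phi> a (J' a) y" "\<phi> a (J' a) y > \<phi> b (J b) y"
      using yW ab by (auto simp: W_def)
    then show False by simp
  qed
  have "topspace B = (\<Union>k\<le>N. \<Union>J\<in>Js k. W J)"
  proof (intro equalityI subsetI)
    fix y assume y: "y \<in> topspace B"
    then obtain J where J: "sum J A \<le> N" "\<And>a. a \<in> A \<Longrightarrow> J a \<le> n a"
      "\<And>a. a \<in> A \<Longrightarrow> \<phi> a (J a) y > 0" "\<And>a l. a \<in> A \<Longrightarrow> J a < l \<Longrightarrow> l \<le> n a \<Longrightarrow> \<phi> a l y \<le> 0"
      using top_index by metis
    have "restrict J A \<in> Js (sum J A)" using J by (auto simp: Js_def)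
    \<comment> \<open>Functions at indices above \<open>J b\<close> are nonpositive at
      \<open>y\<close>, hence below every positive \<open>\<phi> a (J a) y\<close>.\<close>
    moreover have "y \<in> W (restrict J A)"
      using y J(3) le_less_trans[OF J(4) J(3)] unfolding W_def by simp
    ultimately show "y \<in> (\<Union>k\<le>N. \<Union>J\<in>Js k. W J)" using J(1) by blast
  qed (auto simp: W_def)
  moreover have "openin B (\<Union>J\<in>Js k. W J)" for k
    using openW by blast
  moreover have "\<exists>s. continuous_map (subtopology B (\<Union>J\<in>Js k. W J)) E s \<and>
      (\<forall>y\<in>(\<Union>J\<in>Js k. W J). p (s y) = y)" for k
  proof -
    let ?O = "\<lambda>J. {y \<in> topspace B. \<forall>a\<in>A. \<phi> a (J a) y > 0}"
    have "\<forall>J\<in>Js k. \<exists>s. continuous_map (subtopology B (?O J)) E s \<and> (\<forall>y\<in>?O J. p (s y) = y)"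
      using sect by (fastforce simp: Js_def PiE_iff)
    from bchoice[OF this] obtain s where
      s: "\<And>J. J \<in> Js k \<Longrightarrow> continuous_map (subtopology B (?O J)) E (s J)"
        "\<And>J y. J \<in> Js k \<Longrightarrow> y \<in> ?O J \<Longrightarrow> p (s J y) = y"
      by blast
    let ?U = "\<Union>J\<in>Js k. W J"
    obtain g where g: "continuous_map (subtopology B ?U) E g"
      "\<And>y J. J \<in> Js k \<Longrightarrow> y \<in> topspace (subtopology B ?U) \<inter> W J \<Longrightarrow> g y = s J y"
    proof (rule pasting_lemma_exists)
      show "topspace (subtopology B ?U) \<subseteq> ?U" by auto
      show "openin (subtopology B ?U) (W J)" if "J \<in> Js k" for J
        using openW that by (auto simp: openin_subtopology_alt)
      show "continuous_map (subtopology (subtopology B ?U) (W J)) E (s J)" if "J \<in> Js k" for J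
      proof -
        have "W J \<subseteq> ?O J" by (auto simp: W_def)
        then have "continuous_map (subtopology B (W J)) E (s J)"
          using continuous_map_from_subtopology_mono[OF s(1)[OF that]] by blast
        moreover have "?U \<inter> W J = W J" using that by auto
        ultimately show ?thesis by (simp add: subtopology_subtopology)
      qed
      show "s J y = s J' y" if "J \<in> Js k" "J' \<in> Js k"
          "y \<in> topspace (subtopology B ?U) \<inter> W J \<inter> W J'" for J J' y
        using disj[of J k J' y] that by auto
    qed blast
    have "p (g y) = y" if "y \<in> W J" "J \<in> Js k" for y J
    proof -
      have "g y = s J y" using that by (intro g(2)) (auto simp: W_def)
      with s(2)[OF that(2)] that(1) show ?thesis by (auto simp: W_def)
    qed
    with g(1) show ?thesis by blast
  qed
  ultimately show ?thesis
    unfolding secat_le_enat_iff by (intro exI[of _ "\<lambda>k. \<Union>J\<in>Js k. W J"]) blast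
qed

section \<open>Sections of path fibrations as homotopies\<close>

text \<open>By the exponential law, a lift of \<open>f\<close> to paths starting at \<open>b\<close>
  is a curried homotopy from the constant map to \<open>f\<close>.\<close>

lemma section_based_path_space_iff:
  "(\<exists>s. continuous_map Y (based_path_space X b) s \<and> (\<forall>y\<in>topspace Y. s y 1 = f y)) \<longleftrightarrow>
   homotopic_with (\<lambda>_. True) Y X (\<lambda>_. b) f"
proof
  assume "\<exists>s. continuous_map Y (based_path_space X b) s \<and> (\<forall>y\<in>topspace Y. s y 1 = f y)"
  then obtain s where s: "continuous_map Y (path_space X) s"
    "\<And>y. y \<in> topspace Y \<Longrightarrow> s y 0 = b" "\<And>y. y \<in> topspace Y \<Longrightarrow> s y 1 = f y"
    unfolding based_path_space_def continuous_map_in_subtopology by (auto simp: Pi_iff)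
  show "homotopic_with (\<lambda>_. True) Y X (\<lambda>_. b) f"
    using continuous_map_uncurry_path[OF s(1)] s(2,3)
    by (subst homotopic_with) (auto intro!: exI[of _ "\<lambda>(t, y). s y t"])
next
  assume "homotopic_with (\<lambda>_. True) Y X (\<lambda>_. b) f"
  then obtain h where h: "continuous_map (prod_topology (top_of_set {0..1::real}) Y) X h"
    "\<And>y. h (0, y) = b" "\<And>y. h (1, y) = f y"
    unfolding homotopic_with_def by blast
  show "\<exists>s. continuous_map Y (based_path_space X b) s \<and> (\<forall>y\<in>topspace Y. s y 1 = f y)"
    using continuous_map_curry_path[OF h(1)] h(2,3)
    by (intro exI[of _ "\<lambda>y. \<lambda>t\<in>{0..1}. h (t, y)"])
      (auto simp: based_path_space_def continuous_map_in_subtopology)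
qed

text \<open>Travelling from \<open>b\<close> out to \<open>f y k\<close> and back, for one
  \<open>k\<close> after the other, gives a path through the \<open>r\<close> points. It starts at
  \<open>f y 0\<close> and stops at \<open>f y (r - 1)\<close>, so the first and the last excursion
  are halved.\<close>

lemma homotopic_with_concat_section:
  fixes r :: nat
  assumes r: "r \<ge> 2"
    and hom: "\<And>k. k < r \<Longrightarrow> homotopic_with (\<lambda>_. True) Y X (\<lambda>_. b) (\<lambda>y. f y k)"
  obtains s where "continuous_map Y (path_space X) s"
    "\<And>y k. y \<in> topspace Y \<Longrightarrow> k < r \<Longrightarrow> s y (real k / (real r - 1)) = f y k"
proof -
  let ?I = "prod_topology (top_of_set {0..1::real}) Y"
  have "\<forall>k<r. \<exists>h. continuous_map ?I X h \<and> (\<forall>y. h (0, y) = b) \<and> (\<forall>y. h (1, y) = f y k)"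
    using hom unfolding homotopic_with_def by auto
  then obtain h where h: "\<And>k. k < r \<Longrightarrow> continuous_map ?I X (h k)"
    "\<And>k y. k < r \<Longrightarrow> h k (0, y) = b" "\<And>k y. k < r \<Longrightarrow> h k (1, y) = f y k"
    by metis
  \<comment> \<open>This is the distance of the time, stretched to an interval of length
    \<open>r - 1\<close>, from the sampling time \<open>k\<close>. On \<open>T k\<close> the
    parameter \<open>1 - 2 * d k z\<close> is 0 at distance 1/2, which yields \<open>b\<close>, and
    1 at the sampling time, which yields \<open>f y k\<close>.\<close>
  define d where "d k z = \<bar>fst z * (real r - 1) - real k\<bar>" for k and z :: "real \<times> 'a"
  define T where "T k = {z \<in> topspace ?I. d k z \<le> 1/2}" for k
  have cd: "continuous_map ?I euclideanreal (d k)" for k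
  proof -
    have "continuous_map ?I euclideanreal fst"
      using continuous_map_fst[of "top_of_set {0..1::real}" Y]
      by (auto simp: continuous_map_in_subtopology)
    then show ?thesis
      unfolding d_def by (intro continuous_map_real_abs continuous_map_diff continuous_map_real_mult) auto
  qed
  obtain G where G: "continuous_map ?I X G"
    "\<And>z k. k \<in> {..<r} \<Longrightarrow> z \<in> topspace ?I \<inter> T k \<Longrightarrow> G z = h k (1 - 2 * d k z, snd z)"
  proof (rule pasting_lemma_exists_closed)
    show "finite {..<r}" by simp
    show "topspace ?I \<subseteq> \<Union> (T ` {..<r})"
    proof
      fix z assume z: "z \<in> topspace ?I"
      define \<tau> where "\<tau> = fst z * (real r - 1)"
      have \<tau>: "0 \<le> \<tau>" "\<tau> \<le> real r - 1" using z r unfolding \<tau>_def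
        by (auto intro: mult_left_le_one_le)
      \<comment> \<open>Rounding the stretched time to a nearest integer selects a piece that
        contains \<open>z\<close>.\<close>
      define k where "k = nat \<lfloor>\<tau> + 1/2\<rfloor>"
      have "real k = of_int \<lfloor>\<tau> + 1/2\<rfloor>" using \<tau> unfolding k_def by simp
      then have k: "real k \<le> \<tau> + 1/2" "\<tau> + 1/2 < real k + 1" by linarith+
      then have "k < r" using \<tau> by linarith
      moreover have "d k z \<le> 1/2" using k unfolding d_def \<tau>_def[symmetric] by linarith
      ultimately show "z \<in> \<Union> (T ` {..<r})" using z by (auto simp: T_def)
    qed
    show "closedin ?I (T k)" for k
      using closedin_continuous_map_preimage[OF cd[of k], of "{..1/2}"] by (simp add: T_def)
    show "continuous_map (subtopology ?I (T k)) X (\<lambda>z. h k (1 - 2 * d k z, snd z))"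
      if "k \<in> {..<r}" for k
    proof -
      have "continuous_map (subtopology ?I (T k)) euclideanreal (\<lambda>z. 1 - 2 * d k z)"
        using continuous_map_from_subtopology[OF cd]
        by (intro continuous_map_diff continuous_map_real_mult) auto
      then have "continuous_map (subtopology ?I (T k)) ?I (\<lambda>z. (1 - 2 * d k z, snd z))"
        by (auto simp: continuous_map_pairwise o_def continuous_map_in_subtopology T_def d_def
            intro: continuous_map_from_subtopology continuous_map_snd)
      from continuous_map_compose[OF this h(1)] that show ?thesis by (simp add: o_def)
    qed
    show "h i (1 - 2 * d i z, snd z) = h j (1 - 2 * d j z, snd z)"
      if ij: "i \<in> {..<r}" "j \<in> {..<r}" and z: "z \<in> topspace ?I \<inter> T i \<inter> T j" for i j z
    proof (cases "i = j")
      case False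
      \<comment> \<open>Distinct pieces meet only midway between adjacent sampling times, where both
        parameters are 0 and both values are \<open>b\<close>.\<close>
      then have "\<bar>real i - real j\<bar> \<ge> 1" by linarith
      moreover have "d i z \<le> 1/2" "d j z \<le> 1/2" using z by (auto simp: T_def)
      ultimately have "d i z = 1/2" "d j z = 1/2" unfolding d_def by linarith+
      then have "1 - 2 * d i z = 0" "1 - 2 * d j z = 0" by linarith+
      with h(2) ij show ?thesis by simp
    qed simp
  qed blast
  show thesis
  proof
    show "continuous_map Y (path_space X) (\<lambda>y. \<lambda>t\<in>{0..1}. G (t, y))"
      by (rule continuous_map_curry_path[OF G(1)])
    fix y k assume y: "y \<in> topspace Y" and k: "k < r"
    let ?t = "real k / (real r - 1)"
    have t: "?t \<in> {0..1}" "d k (?t, y) = 0" using k r by (auto simp: d_def divide_simps)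
    then have "G (?t, y) = h k (1, y)"
      using G(2)[of k "(?t, y)"] k y by (simp add: T_def)
    with t h(3)[OF k] show "(\<lambda>t\<in>{0..1}. G (t, y)) ?t = f y k" by simp
  qed
qed

subsection \<open>Pointed categorical covers\<close>

text \<open>The members are replaced one at a time by the positivity set of a Urysohn function, and
  a cover is kept throughout.\<close>

lemma normal_space_shrinking_functions:
  assumes normal: "normal_space X"
    and V: "\<And>j. j \<le> n \<Longrightarrow> openin X (V j)" "topspace X = (\<Union>j\<le>n. V j)"
  obtains \<psi> :: "nat \<Rightarrow> 'a \<Rightarrow> real" where
    "\<And>j. j \<le> n \<Longrightarrow> continuous_map X euclideanreal (\<psi> j)"
    "\<And>j x. j \<le> n \<Longrightarrow> x \<in> topspace X \<Longrightarrow> 0 \<le> \<psi> j x"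
    "\<And>j x. j \<le> n \<Longrightarrow> x \<in> topspace X \<Longrightarrow> 0 < \<psi> j x \<Longrightarrow> x \<in> V j"
    "\<And>x. x \<in> topspace X \<Longrightarrow> \<exists>j\<le>n. 0 < \<psi> j x"
proof -
  \<comment> \<open>Invariant: the positivity sets of \<open>\<psi> j\<close> for
    \<open>j < k\<close>, together with the untouched \<open>V j\<close> for
    \<open>k \<le> j \<le> n\<close>, cover the space.\<close>
  have "\<exists>\<psi> :: nat \<Rightarrow> 'a \<Rightarrow> real.
      (\<forall>j<k. continuous_map X euclideanreal (\<psi> j) \<and>
         (\<forall>x\<in>topspace X. 0 \<le> \<psi> j x \<and> (0 < \<psi> j x \<longrightarrow> x \<in> V j))) \<and>
      (\<forall>x\<in>topspace X. (\<exists>j<k. 0 < \<psi> j x) \<or> (\<exists>j\<in>{k..n}. x \<in> V j))"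
    if "k \<le> Suc n" for k
    using that
  proof (induction k)
    case 0
    then show ?case using V(2) by auto
  next
    case (Suc k)
    then obtain \<psi> :: "nat \<Rightarrow> 'a \<Rightarrow> real" where
      \<psi>: "\<And>j. j < k \<Longrightarrow> continuous_map X euclideanreal (\<psi> j)"
      "\<And>j x. j < k \<Longrightarrow> x \<in> topspace X \<Longrightarrow> 0 \<le> \<psi> j x \<and> (0 < \<psi> j x \<longrightarrow> x \<in> V j)"
      and cov: "\<And>x. x \<in> topspace X \<Longrightarrow> (\<exists>j<k. 0 < \<psi> j x) \<or> (\<exists>j\<in>{k..n}. x \<in> V j)"
      by (metis Suc_leD)
    \<comment> \<open>\<open>C\<close> is what the other members miss. It lies in
      \<open>V k\<close>, so normality separates it from the complement of
      \<open>V k\<close>.\<close>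
    define C where "C = topspace X - ((\<Union>j<k. {x \<in> topspace X. 0 < \<psi> j x}) \<union> (\<Union>j\<in>{Suc k..n}. V j))"
    have "openin X {x \<in> topspace X. 0 < \<psi> j x}" if "j < k" for j
      using openin_continuous_map_preimage[OF \<psi>(1)[OF that], of "{0<..}"] by simp
    then have "closedin X C"
      unfolding C_def using V(1) by (intro closedin_diff openin_Un openin_Union) auto
    moreover have "closedin X (topspace X - V k)"
      using V(1) Suc.prems by (intro closedin_diff) auto
    moreover have "disjnt (topspace X - V k) C"
    proof -
      have "x \<in> V k" if "x \<in> C" for x
        using cov[of x] that by (auto simp: C_def) (metis Suc_leI le_neq_implies_less atLeastAtMost_iff)
      then show ?thesis by (auto simp: disjnt_def)
    qed
    ultimately obtain f where f: "continuous_map X (top_of_set {0..1::real}) f"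
      "f ` (topspace X - V k) \<subseteq> {0}" "f ` C \<subseteq> {1}"
      using Urysohn_lemma[OF normal, of "topspace X - V k" C 0 1] by auto
    have f': "continuous_map X euclideanreal f" "\<And>x. x \<in> topspace X \<Longrightarrow> 0 \<le> f x"
      using f(1) by (auto simp: continuous_map_in_subtopology Pi_iff)
    let ?\<psi> = "\<psi>(k := f)"
    have "continuous_map X euclideanreal (?\<psi> j)" if "j < Suc k" for j
      using that \<psi>(1) f'(1) by (auto simp: less_Suc_eq)
    moreover have "0 \<le> ?\<psi> j x \<and> (0 < ?\<psi> j x \<longrightarrow> x \<in> V j)" if "j < Suc k" "x \<in> topspace X" for j x
      using that \<psi>(2) f'(2) f(2) by (force simp: less_Suc_eq)
    moreover have "(\<exists>j<Suc k. 0 < ?\<psi> j x) \<or> (\<exists>j\<in>{Suc k..n}. x \<in> V j)" if "x \<in> topspace X" for x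
    proof (cases "x \<in> C")
      case True
      then have "?\<psi> k x > 0" using f(3) by auto
      then show ?thesis by blast
    next
      case False
      then show ?thesis using that
        by (auto simp: C_def less_Suc_eq intro: exI[of _ "_::nat"])
    qed
    ultimately show ?case by blast
  qed
  from this[of "Suc n"] obtain \<psi> :: "nat \<Rightarrow> 'a \<Rightarrow> real" where
    "\<forall>j<Suc n. continuous_map X euclideanreal (\<psi> j) \<and>
         (\<forall>x\<in>topspace X. 0 \<le> \<psi> j x \<and> (0 < \<psi> j x \<longrightarrow> x \<in> V j))"
    "\<forall>x\<in>topspace X. (\<exists>j<Suc n. 0 < \<psi> j x)"
    by auto
  then show thesis by (intro that[of \<psi>]) (auto simp: less_Suc_eq_le)
qed

lemma homotopic_with_restrict:
  assumes "homotopic_with P X Y f g"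
  shows "homotopic_with P (subtopology X S) Y f g"
  using homotopic_with_compose_continuous_map_right[OF assms, of "subtopology X S" id P] by simp

text \<open>The track of \<open>b\<close> under the contraction \<open>h\<close> is a loop, possibly essential. Sending \<open>b\<close> along
  it and back again is null-homotopic; the factor \<open>l\<close> carries out the null-homotopy as \<open>x\<close>
  approaches \<open>b\<close>.\<close>

lemma pointed_contraction:
  assumes u: "continuous_map X euclideanreal u" "\<And>x. x \<in> topspace X \<Longrightarrow> 0 \<le> u x" "u b = 0"
    and g: "homotopic_with (\<lambda>f. f b = b) X X id g"
      "\<And>x. x \<in> topspace X \<Longrightarrow> u x < 1 \<Longrightarrow> g x = b"
    and U: "homotopic_with (\<lambda>_. True) (subtopology X U) X (\<lambda>_. b) id" "b \<in> U" "b \<in> topspace X"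
    and S: "\<And>x. x \<in> topspace X \<Longrightarrow> x \<in> S \<Longrightarrow> g x \<in> U" "b \<in> S"
  shows "homotopic_with (\<lambda>f. f b = b) (subtopology X S) X (\<lambda>_. b) id"
proof -
  let ?P = "\<lambda>f. f b = b" and ?I = "top_of_set {0..1::real}" and ?S = "subtopology X S"
  obtain h where h: "continuous_map (prod_topology ?I (subtopology X U)) X h"
    "\<And>x. h (0, x) = x" "\<And>x. h (1, x) = b"
    using homotopic_with_symD[OF U(1)] unfolding homotopic_with_def by auto
  \<comment> \<open>\<open>l\<close> vanishes at \<open>b\<close> and equals 1 as soon as
    \<open>u x \<ge> 1/2\<close>, so every point of the space satisfies \<open>g x = b\<close> or
    \<open>l x = 1\<close>.\<close>
  define l where "l x = min 1 (2 * u x)" for x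
  have cu: "continuous_map ?S euclideanreal u"
    by (rule continuous_map_from_subtopology[OF u(1)])
  have "continuous_map ?S euclideanreal l"
    unfolding l_def by (intro continuous_map_real_min continuous_map_real_mult cu) auto
  then have cl: "continuous_map (prod_topology ?I ?S) euclideanreal (\<lambda>z. l (snd z))"
    using continuous_map_compose[OF continuous_map_snd] by (auto simp: o_def)
  have ct: "continuous_map (prod_topology ?I ?S) euclideanreal fst"
    using continuous_map_fst[of ?I ?S] by (auto simp: continuous_map_in_subtopology)
  have l01: "l x \<in> {0..1}" if "x \<in> topspace X" for x using u(2)[OF that] by (auto simp: l_def)
  have lb: "l b = 0" using u(3) by (simp add: l_def)
  have gb: "g b = b" using homotopic_with_imp_property[OF g(1)] by simp
  have cg: "continuous_map ?S X g"
    using homotopic_with_imp_continuous_maps[OF g(1)] continuous_map_from_subtopology by blast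
  have 1: "homotopic_with ?P ?S X id g" by (rule homotopic_with_restrict[OF g(1)])
  have 2: "homotopic_with ?P ?S X g (\<lambda>x. h (l x, b))"
  proof -
    have "continuous_map (prod_topology ?I ?S) (prod_topology ?I (subtopology X U))
        (\<lambda>z. (fst z * l (snd z), g (snd z)))"
      unfolding continuous_map_pairwise o_def fst_conv snd_conv continuous_map_in_subtopology
    proof (intro conjI)
      show "continuous_map (prod_topology ?I ?S) euclideanreal (\<lambda>z. fst z * l (snd z))"
        by (intro continuous_map_real_mult ct cl)
      show "continuous_map (prod_topology ?I ?S) X (\<lambda>z. g (snd z))"
        using continuous_map_compose[OF continuous_map_snd cg] by (simp add: o_def)
    qed (use l01 S(1) in \<open>auto intro!: mult_nonneg_nonneg mult_le_one\<close>)
    from continuous_map_compose[OF this h(1)]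
    have c: "continuous_map (prod_topology ?I ?S) X (\<lambda>z. h (fst z * l (snd z), g (snd z)))"
      by (simp add: o_def)
    \<comment> \<open>For \<open>u x < 1\<close> the arguments coincide; otherwise
      \<open>l x = 1\<close>, and \<open>h\<close> is \<open>b\<close> at time 1.\<close>
    have e: "h (l x, g x) = h (l x, b)" if "x \<in> topspace X" for x
      using g(2)[OF that] h(3) by (cases "u x < 1") (auto simp: l_def)
    show ?thesis
      using c e h(2) lb gb U(3) S(2)
      by (subst homotopic_with) (auto intro!: exI[of _ "\<lambda>z. h (fst z * l (snd z), g (snd z))"])
  qed
  \<comment> \<open>The map to be contracted runs along the track of \<open>b\<close> with parameter
    \<open>l x\<close>; shrinking the parameter to 0 ends at \<open>h (0, b) = b\<close>.\<close>
  have 3: "homotopic_with ?P ?S X (\<lambda>x. h (l x, b)) (\<lambda>_. b)"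
  proof -
    have "continuous_map (prod_topology ?I ?S) (prod_topology ?I (subtopology X U))
        (\<lambda>z. ((1 - fst z) * l (snd z), b))"
      unfolding continuous_map_pairwise o_def fst_conv snd_conv continuous_map_in_subtopology
    proof (intro conjI)
      show "continuous_map (prod_topology ?I ?S) euclideanreal (\<lambda>z. (1 - fst z) * l (snd z))"
        by (intro continuous_map_real_mult continuous_map_diff ct cl) auto
    qed (use l01 U in \<open>auto intro!: mult_nonneg_nonneg mult_le_one\<close>)
    from continuous_map_compose[OF this h(1)]
    have c: "continuous_map (prod_topology ?I ?S) X (\<lambda>z. h ((1 - fst z) * l (snd z), b))"
      by (simp add: o_def)
    show ?thesis
      using c h(2) lb U(3) S(2)
      by (subst homotopic_with) (auto intro!: exI[of _ "\<lambda>z. h ((1 - fst z) * l (snd z), b)"])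
  qed
  show ?thesis
    by (rule homotopic_with_symD[OF homotopic_with_trans[OF 1 homotopic_with_trans[OF 2 3]]])
qed

lemma LS_cat_le_enatD:
  assumes "LS_cat X b \<le> enat n"
  obtains U where "topspace X = (\<Union>i\<le>n. U i)" "\<And>i. i \<le> n \<Longrightarrow> openin X (U i)"
    "\<And>i. i \<le> n \<Longrightarrow> homotopic_with (\<lambda>_. True) (subtopology X (U i)) X (\<lambda>_. b) id"
proof -
  obtain U where U: "topspace X = (\<Union>i\<le>n. U i)" "\<And>i. i \<le> n \<Longrightarrow> openin X (U i)"
    "\<And>i. i \<le> n \<Longrightarrow> \<exists>s. continuous_map (subtopology X (U i)) (based_path_space X b) s \<and>
        (\<forall>x\<in>U i. s x 1 = x)"
    using assms unfolding LS_cat_def secat_le_enat_iff by metis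
  have "homotopic_with (\<lambda>_. True) (subtopology X (U i)) X (\<lambda>_. b) id" if "i \<le> n" for i
    using U(3)[OF that] by (subst section_based_path_space_iff[symmetric]) auto
  with U(1,2) show thesis by (intro that)
qed

text \<open>After pulling the cover back along \<open>g\<close>, one member contains all of
  \<open>{u < 1}\<close>, so the others can be cut away from \<open>b\<close>. A new member
  containing \<open>b\<close> is contracted by \<open>pointed_contraction\<close>; any other is
  deformed by \<open>g\<close> into \<open>U j\<close> and contracted from there.\<close>

lemma well_pointed_categorical_cover:
  fixes X :: "'a topology"
  assumes normal: "normal_space X" and wp: "well_pointed X b" and cat: "LS_cat X b \<le> enat n"
  obtains \<phi> :: "nat \<Rightarrow> 'a \<Rightarrow> real" where
    "\<And>j. j \<le> n \<Longrightarrow> continuous_map X euclideanreal (\<phi> j)"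
    "\<And>x. x \<in> topspace X \<Longrightarrow> \<exists>j\<le>n. 0 < \<phi> j x"
    "\<And>j. 0 < j \<Longrightarrow> \<phi> j b = 0"
    "\<And>j. j \<le> n \<Longrightarrow> homotopic_with (\<lambda>f. 0 < \<phi> j b \<longrightarrow> f b = b)
        (subtopology X {x. 0 < \<phi> j x}) X (\<lambda>_. b) id"
proof -
  obtain u g where b: "b \<in> topspace X" and u: "continuous_map X euclideanreal u"
    "\<And>x. x \<in> topspace X \<Longrightarrow> 0 \<le> u x" "\<And>x. x \<in> topspace X \<Longrightarrow> u x = 0 \<longleftrightarrow> x = b"
    and g: "homotopic_with (\<lambda>f. f b = b) X X id g"
      "\<And>x. x \<in> topspace X \<Longrightarrow> u x < 1 \<Longrightarrow> g x = b"
    using wp unfolding well_pointed_def by metis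
  obtain U0 where U0: "topspace X = (\<Union>i\<le>n. U0 i)" "\<And>i. i \<le> n \<Longrightarrow> openin X (U0 i)"
    "\<And>i. i \<le> n \<Longrightarrow> homotopic_with (\<lambda>_. True) (subtopology X (U0 i)) X (\<lambda>_. b) id"
    using LS_cat_le_enatD[OF cat] by blast
  obtain k where k: "k \<le> n" "b \<in> U0 k" using U0(1) b by auto
  \<comment> \<open>The transposition moves a member containing \<open>b\<close> to index 0.\<close>
  define U where "U = U0 \<circ> Transposition.transpose 0 k"
  have tr: "Transposition.transpose 0 k i \<le> n" if "i \<le> n" for i
    using that k(1) by (auto simp: Transposition.transpose_def)
  have U: "openin X (U i)" "homotopic_with (\<lambda>_. True) (subtopology X (U i)) X (\<lambda>_. b) id"
    if "i \<le> n" for i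
    using U0(2,3)[OF tr[OF that]] by (auto simp: U_def)
  have bU: "b \<in> U 0" using k by (simp add: U_def)
  have cg: "continuous_map X X g" using homotopic_with_imp_continuous_maps[OF g(1)] by simp
  have gb: "g b = b" using homotopic_with_imp_property[OF g(1)] by simp
  have covU: "\<exists>i\<le>n. x \<in> U i" if x: "x \<in> topspace X" for x
  proof -
    obtain i where "i \<le> n" "x \<in> U0 i" using U0(1) x by auto
    then show ?thesis using tr by (intro exI[of _ "Transposition.transpose 0 k i"]) (simp add: U_def)
  qed
  have "g x \<in> topspace X" if "x \<in> topspace X" for x
    using continuous_map_funspace[OF cg] that by auto
  with covU have gcov: "topspace X = (\<Union>i\<le>n. {x \<in> topspace X. g x \<in> U i})" by blast
  have gopen: "openin X {x \<in> topspace X. g x \<in> U i}" if "i \<le> n" for i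
    by (rule openin_continuous_map_preimage[OF cg U(1)[OF that]])
  obtain \<psi> :: "nat \<Rightarrow> 'a \<Rightarrow> real" where
    \<psi>: "\<And>j. j \<le> n \<Longrightarrow> continuous_map X euclideanreal (\<psi> j)"
      "\<And>j x. j \<le> n \<Longrightarrow> x \<in> topspace X \<Longrightarrow> 0 \<le> \<psi> j x"
      "\<And>j x. j \<le> n \<Longrightarrow> x \<in> topspace X \<Longrightarrow> 0 < \<psi> j x \<Longrightarrow> x \<in> {x \<in> topspace X. g x \<in> U j}"
      "\<And>x. x \<in> topspace X \<Longrightarrow> \<exists>j\<le>n. 0 < \<psi> j x"
    using normal_space_shrinking_functions[OF normal gopen gcov] by blast
  \<comment> \<open>The bump \<open>max 0 (1 - u x)\<close> puts \<open>b\<close> into member 0 and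
    is positive only where \<open>g x = b\<close>. The factor \<open>u x\<close> removes
    \<open>b\<close> from the other members and does not affect positivity elsewhere.\<close>
  define \<phi> where "\<phi> j x = (if j = 0 then \<psi> 0 x + max 0 (1 - u x) else \<psi> j x * u x)" for j x
  have cont: "continuous_map X euclideanreal (\<phi> j)" if "j \<le> n" for j
    using \<psi>(1)[OF that] u(1) unfolding \<phi>_def
    by (cases "j = 0") (simp_all add: continuous_map_add continuous_map_real_max
        continuous_map_diff continuous_map_real_mult)
  have ub: "u b = 0" using u(3) b by simp
  have gU: "g x \<in> U j" if "j \<le> n" "x \<in> topspace X" "0 < \<phi> j x" for j x
  proof (cases "j = 0 \<and> u x < 1")
    case True
    then show ?thesis using g(2)[OF that(2)] bU by simp
  next
    case False
    then have "0 < \<psi> j x"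
      using that \<psi>(2)[OF that(1,2)] u(2)[OF that(2)]
      by (auto simp: \<phi>_def zero_less_mult_iff split: if_splits)
    then show ?thesis using \<psi>(3) that by blast
  qed
  show thesis
  proof (rule that[of \<phi>])
    show "\<exists>j\<le>n. 0 < \<phi> j x" if x: "x \<in> topspace X" for x
    proof (cases "x = b")
      case True
      then show ?thesis using ub \<psi>(2)[of 0 x] x by (intro exI[of _ 0]) (simp add: \<phi>_def)
    next
      case False
      obtain j where j: "j \<le> n" "0 < \<psi> j x" using \<psi>(4)[OF x] by blast
      have "0 < u x" using u(2,3)[OF x] False by (simp add: less_le)
      then show ?thesis using j by (intro exI[of _ j]) (auto simp: \<phi>_def)
    qed
    show "\<phi> j b = 0" if "0 < j" for j using that ub by (simp add: \<phi>_def)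
    show "homotopic_with (\<lambda>f. 0 < \<phi> j b \<longrightarrow> f b = b)
        (subtopology X {x. 0 < \<phi> j x}) X (\<lambda>_. b) id" if j: "j \<le> n" for j
    proof (cases "0 < \<phi> j b")
      case True
      then have "b \<in> U j" using gU[OF j b] gb by simp
      with True show ?thesis
        using pointed_contraction[OF u(1,2) ub g U(2)[OF j] _ b, of "{x. 0 < \<phi> j x}"] gU j by simp
    next
      \<comment> \<open>The member misses \<open>b\<close>, so a free homotopy is enough.\<close>
      case False
      let ?S = "subtopology X {x. 0 < \<phi> j x}"
      have 1: "homotopic_with (\<lambda>_. True) ?S X id g"
        by (rule homotopic_with_mono[OF homotopic_with_restrict[OF g(1)]]) simp
      have "continuous_map ?S (subtopology X (U j)) g"
        using continuous_map_from_subtopology[OF cg] gU[OF j]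
        by (auto simp: continuous_map_in_subtopology)
      then have "homotopic_with (\<lambda>_. True) ?S X ((\<lambda>_. b) \<circ> g) (id \<circ> g)"
        by (rule homotopic_with_compose_continuous_map_right[OF U(2)[OF j]]) simp
      then have 2: "homotopic_with (\<lambda>_. True) ?S X (\<lambda>_. b) g"
        by (simp add: o_def)
      have "homotopic_with (\<lambda>_. True) ?S X (\<lambda>_. b) id"
        by (rule homotopic_with_trans[OF 2 homotopic_with_symD[OF 1]])
      with False show ?thesis by simp
    qed
  qed (rule cont)
qed

subsection \<open>Polyhedral products\<close>

lemma continuous_map_polyhedral_product_component:
  assumes "i \<in> V"
  shows "continuous_map (polyhedral_product V X pt K) (X i) (\<lambda>x. x i)"
  unfolding polyhedral_product_def
  using assms by (intro continuous_map_from_subtopology continuous_map_product_projection)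

text \<open>A coordinate outside \<open>\<sigma>\<close> is the base point; it then lies in
  \<open>S i\<close> and is fixed by the contraction there. The coordinatewise homotopy therefore
  never leaves the piece of \<open>\<sigma>\<close>.\<close>

lemma polyhedral_product_contraction:
  assumes hom: "\<And>i. i \<in> V \<Longrightarrow> homotopic_with (\<lambda>f. pt i \<in> S i \<longrightarrow> f (pt i) = pt i)
      (subtopology (X i) (S i)) (X i) (\<lambda>_. pt i) id"
  shows "homotopic_with (\<lambda>_. True)
      (subtopology (polyhedral_product V X pt K) {x. \<forall>i\<in>V. x i \<in> S i})
      (polyhedral_product V X pt K) (\<lambda>_. restrict pt V) id"
proof -
  let ?I = "top_of_set {0..1::real}" and ?P = "polyhedral_product V X pt K"
  let ?O = "subtopology ?P {x. \<forall>i\<in>V. x i \<in> S i}"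
  have "\<forall>i\<in>V. \<exists>h. continuous_map (prod_topology ?I (subtopology (X i) (S i))) (X i) h \<and>
      (\<forall>x. h (0, x) = pt i) \<and> (\<forall>x. h (1, x) = x) \<and>
      (\<forall>t\<in>{0..1}. pt i \<in> S i \<longrightarrow> h (t, pt i) = pt i)"
    using hom unfolding homotopic_with_def by simp
  then obtain h where h: "\<And>i. i \<in> V \<Longrightarrow>
        continuous_map (prod_topology ?I (subtopology (X i) (S i))) (X i) (h i)"
    "\<And>i x. i \<in> V \<Longrightarrow> h i (0, x) = pt i" "\<And>i x. i \<in> V \<Longrightarrow> h i (1, x) = x"
    "\<And>i t. i \<in> V \<Longrightarrow> t \<in> {0..1} \<Longrightarrow> pt i \<in> S i \<Longrightarrow> h i (t, pt i) = pt i"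
    by (metis (no_types, lifting))
  define H where "H z = (\<lambda>i\<in>V. h i (fst z, snd z i))" for z
  have comp: "continuous_map (prod_topology ?I ?O) (X i) (\<lambda>z. h i (fst z, snd z i))" if i: "i \<in> V" for i
  proof -
    have "continuous_map ?O (subtopology (X i) (S i)) (\<lambda>x. x i)"
      using i continuous_map_polyhedral_product_component[OF i]
      by (auto simp: continuous_map_in_subtopology intro: continuous_map_from_subtopology)
    from continuous_map_compose[OF continuous_map_snd this]
    have "continuous_map (prod_topology ?I ?O) (prod_topology ?I (subtopology (X i) (S i)))
        (\<lambda>z. (fst z, snd z i))"
      using continuous_map_fst[of ?I ?O] by (simp add: continuous_map_pairwise o_def)
    from continuous_map_compose[OF this h(1)[OF i]] show ?thesis by (simp add: o_def)
  qed
  have val: "h i (t, y i) \<in> topspace (X i)"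
    if "i \<in> V" "t \<in> {0..1}" "y \<in> topspace ?O" for i t y
    using continuous_map_funspace[OF comp[OF that(1)]] that by force
  have "continuous_map (prod_topology ?I ?O) (product_topology X V) H"
    unfolding continuous_map_componentwise
    using comp by (simp add: H_def image_subset_iff)
  moreover have "H z \<in> (\<Union>\<sigma>\<in>K. \<Pi>\<^sub>E i\<in>V. if i \<in> \<sigma> then topspace (X i) else {pt i})"
    if zI: "z \<in> topspace (prod_topology ?I ?O)" for z
  proof -
    obtain t y where z: "z = (t, y)" "t \<in> {0..1}" "y \<in> topspace ?O" using zI by auto
    obtain \<sigma> where \<sigma>: "\<sigma> \<in> K" "y \<in> (\<Pi>\<^sub>E i\<in>V. if i \<in> \<sigma> then topspace (X i) else {pt i})"
      using z(3) by (auto simp: polyhedral_product_def)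
    have "h i (t, y i) = pt i" if "i \<in> V" "i \<notin> \<sigma>" for i
    proof -
      have "y i = pt i" using \<sigma>(2) that by (auto simp: PiE_iff split: if_splits)
      moreover have "y i \<in> S i" using z(3) that by auto
      ultimately show ?thesis using h(4) that z(2) by metis
    qed
    then have "H z \<in> (\<Pi>\<^sub>E i\<in>V. if i \<in> \<sigma> then topspace (X i) else {pt i})"
      using val[OF _ z(2,3)] by (auto simp: H_def z(1))
    with \<sigma>(1) show ?thesis by blast
  qed
  ultimately have "continuous_map (prod_topology ?I ?O) ?P H"
    unfolding polyhedral_product_def continuous_map_in_subtopology by blast
  \<comment> \<open>\<open>H (1, y) = y\<close> requires \<open>y\<close> to be
    \<open>undefined\<close> off \<open>V\<close>, which membership in the carrier supplies.\<close>
  moreover have "H (0, y) = restrict pt V" "y \<in> topspace ?O \<Longrightarrow> H (1, y) = y" for y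
    using h(2,3) by (auto simp: H_def polyhedral_product_def PiE_iff extensional_def)
  ultimately show ?thesis
    by (subst homotopic_with) auto
qed

section \<open>Monotonicity under retracts and the lower bounds\<close>

text \<open>Composition with \<open>q\<close> turns paths from \<open>b\<close> into paths from
  \<open>q b\<close>, which explains the base point on the left.\<close>

lemma LS_cat_retract_le:
  assumes f: "continuous_map Y X f" and q: "continuous_map X Y q"
    and qf: "\<And>y. y \<in> topspace Y \<Longrightarrow> q (f y) = y"
  shows "LS_cat Y (q b) \<le> LS_cat X b"
  unfolding LS_cat_def
proof (rule secat_retract_le[OF f _ _ qf])
  show "continuous_map (based_path_space X b) (based_path_space Y (q b))
      (\<lambda>\<alpha>. \<lambda>t\<in>{0..1}. q (\<alpha> t))"
    unfolding based_path_space_def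
    using continuous_map_path_space_compose[OF q]
    by (auto simp: continuous_map_in_subtopology intro: continuous_map_from_subtopology)
qed auto

text \<open>\<open>f\<close> acts on each of the \<open>r\<close> points and \<open>q\<close> on the
  connecting path, which then passes through the original points.\<close>

lemma TC_retract_le:
  assumes f: "continuous_map Y X f" and q: "continuous_map X Y q"
    and qf: "\<And>y. y \<in> topspace Y \<Longrightarrow> q (f y) = y" and r: "r \<ge> 2"
  shows "TC r Y \<le> TC r X"
  unfolding TC_def
proof (rule secat_retract_le)
  show "continuous_map (product_topology (\<lambda>_. Y) {..<r}) (product_topology (\<lambda>_. X) {..<r})
      (\<lambda>y. \<lambda>k\<in>{..<r}. f (y k))"
  proof -
    have "continuous_map (product_topology (\<lambda>_. Y) {..<r}) X (f \<circ> (\<lambda>y. y k))" if "k < r" for k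
      using that by (intro continuous_map_compose[OF _ f] continuous_map_product_projection) simp
    then show ?thesis by (auto simp: continuous_map_componentwise o_def)
  qed
  show "continuous_map (path_space X) (path_space Y) (\<lambda>\<alpha>. \<lambda>t\<in>{0..1}. q (\<alpha> t))"
    by (rule continuous_map_path_space_compose[OF q])
  \<comment> \<open>For \<open>r \<ge> 2\<close> the sampling times lie in \<open>{0..1}\<close>,
    where the restricted path has its intended values.\<close>
  show "(\<lambda>j\<in>{..<r}. (\<lambda>t\<in>{0..1}. q (\<alpha> t)) (real j / (real r - 1))) =
      (\<lambda>x. \<lambda>j\<in>{..<r}. q (x j)) (\<lambda>j\<in>{..<r}. \<alpha> (real j / (real r - 1)))" for \<alpha>
    using r by (intro ext) (auto simp: divide_simps)
  show "(\<lambda>j\<in>{..<r}. q ((\<lambda>k\<in>{..<r}. f (y k)) j)) = y"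
    if "y \<in> topspace (product_topology (\<lambda>_. Y) {..<r})" for y
    using that qf by (intro ext) (auto simp: PiE_iff extensional_def)
qed

text \<open>Filling the missing coordinates with base points embeds the product over
  \<open>\<sigma>\<close>, and forgetting those coordinates is a left inverse.\<close>

lemma LS_cat_TC_product_le_polyhedral_product:
  assumes pt: "\<And>i. i \<in> V \<Longrightarrow> pt i \<in> topspace (X i)" and \<sigma>: "\<sigma> \<in> K" "\<sigma> \<subseteq> V"
  shows "LS_cat (product_topology X \<sigma>) (restrict pt \<sigma>)
      \<le> LS_cat (polyhedral_product V X pt K) (restrict pt V)"
    and "r \<ge> 2 \<Longrightarrow> TC r (product_topology X \<sigma>) \<le> TC r (polyhedral_product V X pt K)"
proof -
  let ?f = "\<lambda>x. \<lambda>i\<in>V. if i \<in> \<sigma> then x i else pt i"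
  have "continuous_map (product_topology X \<sigma>) (product_topology X V) ?f"
  proof -
    have "continuous_map (product_topology X \<sigma>) (X i) (\<lambda>x. if i \<in> \<sigma> then x i else pt i)"
      if "i \<in> V" for i
      using that pt by (cases "i \<in> \<sigma>") (auto intro: continuous_map_product_projection)
    then show ?thesis by (auto simp: continuous_map_componentwise)
  qed
  moreover have "?f x \<in> (\<Pi>\<^sub>E i\<in>V. if i \<in> \<sigma> then topspace (X i) else {pt i})"
    if "x \<in> topspace (product_topology X \<sigma>)" for x
    using that by (auto simp: PiE_iff)
  ultimately have f: "continuous_map (product_topology X \<sigma>) (polyhedral_product V X pt K) ?f"
    unfolding polyhedral_product_def continuous_map_in_subtopology using \<sigma>(1) by blast
  have q: "continuous_map (polyhedral_product V X pt K) (product_topology X \<sigma>) (\<lambda>x. restrict x \<sigma>)"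
    using \<sigma>(2) by (auto simp: continuous_map_componentwise
        intro: continuous_map_polyhedral_product_component)
  have qf: "restrict (?f y) \<sigma> = y" if "y \<in> topspace (product_topology X \<sigma>)" for y
    using that \<sigma>(2) by (intro ext) (auto simp: PiE_iff extensional_def)
  have "restrict (restrict pt V) \<sigma> = restrict pt \<sigma>"
    using \<sigma>(2) by (simp add: Int_absorb1)
  then show "LS_cat (product_topology X \<sigma>) (restrict pt \<sigma>)
      \<le> LS_cat (polyhedral_product V X pt K) (restrict pt V)"
    using LS_cat_retract_le[where q = "\<lambda>x. restrict x \<sigma>" and b = "restrict pt V", OF f q qf] by simp
  show "TC r (product_topology X \<sigma>) \<le> TC r (polyhedral_product V X pt K)" if "r \<ge> 2"
    by (rule TC_retract_le[where q = "\<lambda>x. restrict x \<sigma>", OF f q qf that])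
qed

section \<open>Upper bounds from graded covers\<close>

text \<open>Both bounds are instances of \<open>secat_le_of_graded_functions\<close>. Its index set
  is \<open>V\<close> for the category, and for \<open>TC\<close> it consists of the pairs of a
  point number \<open>k < r\<close> and a vertex.\<close>

lemma LS_cat_TC_polyhedral_product_le:
  fixes X :: "'v \<Rightarrow> 'a topology" and n :: "'v \<Rightarrow> nat"
  assumes V: "finite V"
    and normal: "\<And>i. i \<in> V \<Longrightarrow> normal_space (X i)"
    and wp: "\<And>i. i \<in> V \<Longrightarrow> well_pointed (X i) (pt i)"
    and cat: "\<And>i. i \<in> V \<Longrightarrow> LS_cat (X i) (pt i) \<le> enat (n i)"
    and K: "\<And>\<sigma>. \<sigma> \<in> K \<Longrightarrow> \<sigma> \<subseteq> V" "\<And>\<sigma>. \<sigma> \<in> K \<Longrightarrow> sum n \<sigma> \<le> N"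
  shows "LS_cat (polyhedral_product V X pt K) (restrict pt V) \<le> enat N"
    and "r \<ge> 2 \<Longrightarrow> TC r (polyhedral_product V X pt K) \<le> enat (r * N)"
proof -
  let ?P = "polyhedral_product V X pt K"
  let ?cover = "\<lambda>i (\<phi> :: nat \<Rightarrow> 'a \<Rightarrow> real).
    (\<forall>j\<le>n i. continuous_map (X i) euclideanreal (\<phi> j)) \<and>
    (\<forall>x\<in>topspace (X i). \<exists>j\<le>n i. 0 < \<phi> j x) \<and>
    (\<forall>j>0. \<phi> j (pt i) = 0) \<and>
    (\<forall>j\<le>n i. homotopic_with (\<lambda>f. 0 < \<phi> j (pt i) \<longrightarrow> f (pt i) = pt i)
        (subtopology (X i) {x. 0 < \<phi> j x}) (X i) (\<lambda>_. pt i) id)"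
  have "\<exists>\<phi>. ?cover i \<phi>" if i: "i \<in> V" for i
    by (rule well_pointed_categorical_cover[OF normal[OF i] wp[OF i] cat[OF i]]) blast
  then have "\<forall>i\<in>V. \<exists>\<phi>. ?cover i \<phi>" ..
  from bchoice[OF this] obtain \<phi> where \<phi>: "\<forall>i\<in>V. ?cover i (\<phi> i)" ..
  have cont: "continuous_map (X i) euclideanreal (\<phi> i j)" if "i \<in> V" "j \<le> n i" for i j
    using \<phi> that by blast
  have cov: "\<exists>j\<le>n i. 0 < \<phi> i j x" if "i \<in> V" "x \<in> topspace (X i)" for i x
    using \<phi> that by blast
  have base: "\<phi> i j (pt i) = 0" if "i \<in> V" "0 < j" for i j
    using \<phi> that by blast
  have hom: "homotopic_with (\<lambda>f. 0 < \<phi> i j (pt i) \<longrightarrow> f (pt i) = pt i)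
      (subtopology (X i) {x. 0 < \<phi> i j x}) (X i) (\<lambda>_. pt i) id" if "i \<in> V" "j \<le> n i" for i j
    using \<phi> that by blast
  have contraction: "homotopic_with (\<lambda>_. True)
      (subtopology ?P {x. \<forall>i\<in>V. 0 < \<phi> i (J i) (x i)}) ?P (\<lambda>_. restrict pt V) id"
    if "\<And>i. i \<in> V \<Longrightarrow> J i \<le> n i" for J
    using polyhedral_product_contraction[of V pt "\<lambda>i. {x. 0 < \<phi> i (J i) x}" X K] hom that by simp
  have contP: "continuous_map ?P euclideanreal (\<lambda>x. \<phi> i l (x i))" if "i \<in> V" "l \<le> n i" for i l
  proof -
    have "continuous_map ?P euclideanreal (\<phi> i l \<circ> (\<lambda>x. x i))"
      using that by (intro continuous_map_compose[OF _ cont] continuous_map_polyhedral_product_component)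
    then show ?thesis by (simp add: o_def)
  qed
  have top_index: "\<exists>J. sum J V \<le> N \<and> (\<forall>i\<in>V. J i \<le> n i \<and> \<phi> i (J i) (y i) > 0 \<and>
      (\<forall>l. J i < l \<and> l \<le> n i \<longrightarrow> \<phi> i l (y i) \<le> 0))" if y: "y \<in> topspace ?P" for y
  proof -
    obtain \<sigma> where \<sigma>: "\<sigma> \<in> K" "\<And>i. i \<in> V \<Longrightarrow> i \<notin> \<sigma> \<Longrightarrow> y i = pt i"
      using y by (fastforce simp: polyhedral_product_def PiE_iff split: if_splits)
    have yX: "y i \<in> topspace (X i)" if "i \<in> V" for i
      using y that by (auto simp: polyhedral_product_def)
    define M where "M i = {j. j \<le> n i \<and> 0 < \<phi> i j (y i)}" for i
    \<comment> \<open>Taking the largest index with a positive value makes all later functions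
      nonpositive at \<open>y\<close>.\<close>
    define J where "J i = Max (M i)" for i
    have fin: "finite (M i)" for i unfolding M_def by simp
    have J: "J i \<in> M i" if "i \<in> V" for i
      unfolding J_def using cov[OF that yX[OF that]] fin by (intro Max_in) (auto simp: M_def)
    have upper: "\<phi> i l (y i) \<le> 0" if "J i < l" "l \<le> n i" for i l
    proof (rule ccontr)
      assume "\<not> \<phi> i l (y i) \<le> 0"
      then have "l \<le> J i" unfolding J_def using that fin by (intro Max_ge) (auto simp: M_def)
      with that show False by simp
    qed
    \<comment> \<open>Off \<open>\<sigma>\<close> the coordinate is the base point, where only the
      function number 0 can be positive.\<close>
    have "J i = 0" if "i \<in> V - \<sigma>" for i
      using J[of i] base[of i "J i"] \<sigma>(2)[of i] that by (auto simp: M_def)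
    then have "sum J V = sum J \<sigma>"
      using V K(1)[OF \<sigma>(1)] by (intro sum.mono_neutral_right) auto
    also have "\<dots> \<le> sum n \<sigma>"
      using J K(1)[OF \<sigma>(1)] by (intro sum_mono) (auto simp: M_def)
    also have "\<dots> \<le> N" by (rule K(2)[OF \<sigma>(1)])
    finally show ?thesis using J upper by (intro exI[of _ J]) (auto simp: M_def)
  qed
  show "LS_cat ?P (restrict pt V) \<le> enat N"
    unfolding LS_cat_def
  proof (rule secat_le_of_graded_functions[where A = V and n = n and \<phi> = "\<lambda>i l y. \<phi> i l (y i)",
        OF V contP top_index])
    fix J assume J: "\<And>i. i \<in> V \<Longrightarrow> J i \<le> n i"
    let ?O = "subtopology ?P {x. \<forall>i\<in>V. 0 < \<phi> i (J i) (x i)}"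
    have "\<exists>s. continuous_map ?O (based_path_space ?P (restrict pt V)) s \<and>
        (\<forall>y\<in>topspace ?O. s y 1 = id y)"
      by (simp only: section_based_path_space_iff contraction[OF J])
    moreover have "?O = subtopology ?P {x \<in> topspace ?P. \<forall>i\<in>V. 0 < \<phi> i (J i) (x i)}"
      using subtopology_restrict[of ?P "{x. \<forall>i\<in>V. 0 < \<phi> i (J i) (x i)}"] by (simp add: Int_def)
    ultimately show "\<exists>s. continuous_map
        (subtopology ?P {x \<in> topspace ?P. \<forall>i\<in>V. 0 < \<phi> i (J i) (x i)})
        (based_path_space ?P (restrict pt V)) s \<and>
        (\<forall>y\<in>topspace ?P. (\<forall>i\<in>V. 0 < \<phi> i (J i) (y i)) \<longrightarrow> s y 1 = y)"
      by auto
  qed auto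
  show "TC r ?P \<le> enat (r * N)" if r: "r \<ge> 2"
    unfolding TC_def
  proof (rule secat_le_of_graded_functions[where A = "{..<r} \<times> V" and n = "\<lambda>(k, i). n i"
        and \<phi> = "\<lambda>(k, i) l y. \<phi> i l (y k i)"])
    let ?Pr = "product_topology (\<lambda>_. ?P) {..<r}"
    show "finite ({..<r} \<times> V)" using V by simp
    show "continuous_map ?Pr euclideanreal ((case a of (k, i) \<Rightarrow> \<lambda>l y. \<phi> i l (y k i)) l)"
      if "a \<in> {..<r} \<times> V" "l \<le> (case a of (k, i) \<Rightarrow> n i)" for a l
    proof -
      obtain k i where a: "a = (k, i)" "k < r" "i \<in> V" using \<open>a \<in> {..<r} \<times> V\<close> by auto
      with that have "continuous_map ?Pr euclideanreal ((\<lambda>x. \<phi> i l (x i)) \<circ> (\<lambda>y. y k))"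
        by (intro continuous_map_compose[OF _ contP] continuous_map_product_projection) auto
      then show ?thesis using a by (simp add: o_def)
    qed
    show "\<exists>J. sum J ({..<r} \<times> V) \<le> r * N \<and> (\<forall>a\<in>{..<r} \<times> V. J a \<le> (case a of (k, i) \<Rightarrow> n i) \<and>
        0 < (case a of (k, i) \<Rightarrow> \<lambda>l y. \<phi> i l (y k i)) (J a) y \<and>
        (\<forall>l. J a < l \<and> l \<le> (case a of (k, i) \<Rightarrow> n i) \<longrightarrow>
          (case a of (k, i) \<Rightarrow> \<lambda>l y. \<phi> i l (y k i)) l y \<le> 0))"
      if y: "y \<in> topspace ?Pr" for y
    proof -
      have "\<forall>k\<in>{..<r}. \<exists>J. sum J V \<le> N \<and> (\<forall>i\<in>V. J i \<le> n i \<and> \<phi> i (J i) (y k i) > 0 \<and>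
          (\<forall>l. J i < l \<and> l \<le> n i \<longrightarrow> \<phi> i l (y k i) \<le> 0))"
        using y by (intro ballI top_index) auto
      from bchoice[OF this] obtain J where J: "\<forall>k\<in>{..<r}. sum (J k) V \<le> N \<and>
          (\<forall>i\<in>V. J k i \<le> n i \<and> \<phi> i (J k i) (y k i) > 0 \<and>
            (\<forall>l. J k i < l \<and> l \<le> n i \<longrightarrow> \<phi> i l (y k i) \<le> 0))" ..
      have "sum (\<lambda>(k, i). J k i) ({..<r} \<times> V) = (\<Sum>k<r. sum (J k) V)"
        by (simp add: sum.cartesian_product)
      also have "\<dots> \<le> r * N"
        using sum_bounded_above[of "{..<r}" "\<lambda>k. sum (J k) V" N] J by simp
      finally show ?thesis using J by (intro exI[of _ "\<lambda>(k, i). J k i"]) auto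
    qed
    fix J assume J: "\<And>a. a \<in> {..<r} \<times> V \<Longrightarrow> J a \<le> (case a of (k, i) \<Rightarrow> n i)"
    let ?O = "{y \<in> topspace ?Pr. \<forall>a\<in>{..<r} \<times> V. 0 < (case a of (k, i) \<Rightarrow> \<lambda>l y. \<phi> i l (y k i)) (J a) y}"
    \<comment> \<open>Each of the \<open>r\<close> points is contracted separately: its own indices
      \<open>J (k, i)\<close> select an open set that contracts in \<open>?P\<close>.\<close>
    have homO: "homotopic_with (\<lambda>_. True) (subtopology ?Pr ?O) ?P (\<lambda>_. restrict pt V) (\<lambda>y. y k)"
      if k: "k < r" for k
    proof -
      let ?S = "subtopology ?P {x. \<forall>i\<in>V. 0 < \<phi> i (J (k, i)) (x i)}"
      have "continuous_map (subtopology ?Pr ?O) ?P (\<lambda>y. y k)"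
        using k by (intro continuous_map_from_subtopology continuous_map_product_projection) simp
      then have proj: "continuous_map (subtopology ?Pr ?O) ?S (\<lambda>y. y k)"
        using k by (auto simp: continuous_map_in_subtopology)
      have "homotopic_with (\<lambda>_. True) ?S ?P (\<lambda>_. restrict pt V) id"
        using J k by (intro contraction) auto
      then have "homotopic_with (\<lambda>_. True) (subtopology ?Pr ?O) ?P
          ((\<lambda>_. restrict pt V) \<circ> (\<lambda>y. y k)) (id \<circ> (\<lambda>y. y k))"
        by (rule homotopic_with_compose_continuous_map_right[OF _ proj]) simp
      then show ?thesis by (simp add: o_def)
    qed
    obtain s where s: "continuous_map (subtopology ?Pr ?O) (path_space ?P) s"
      "\<And>y k. y \<in> topspace (subtopology ?Pr ?O) \<Longrightarrow> k < r \<Longrightarrow> s y (real k / (real r - 1)) = y k"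
      using homotopic_with_concat_section[OF r, where f = "\<lambda>y. y", OF homO] by blast
    \<comment> \<open>For \<open>j \<ge> r\<close> both sides are \<open>undefined\<close>.\<close>
    have "(\<lambda>j\<in>{..<r}. s y (real j / (real r - 1))) = y" if "y \<in> ?O" for y
    proof
      fix j
      show "(\<lambda>j\<in>{..<r}. s y (real j / (real r - 1))) j = y j"
        using s(2)[of y j] that by (cases "j < r") (auto simp: PiE_iff extensional_def)
    qed
    with s(1) show "\<exists>s. continuous_map (subtopology ?Pr ?O) (path_space ?P) s \<and>
      (\<forall>y\<in>topspace ?Pr. (\<forall>a\<in>{..<r} \<times> V. 0 < (case a of (k, i) \<Rightarrow> \<lambda>l y. \<phi> i l (y k i)) (J a) y) \<longrightarrow>
         (\<lambda>j\<in>{..<r}. s y (real j / (real r - 1))) = y)"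
      by blast
  qed
qed

text \<open>Both quantities are squeezed onto the maximum: from below by the retractions onto the
  products over simplices, from above by the graded covers, whose bound applies to finite
  categories.\<close>

theorem theorem1p6:
  fixes r m :: nat
    and X :: "nat \<Rightarrow> 'a topology"
    and pt :: "nat \<Rightarrow> 'a"
    and K :: "nat set set"
  assumes r: "r \<ge> 2"
    and normal: "\<And>i. i \<in> {1..m} \<Longrightarrow> normal_space (X i)"
    and path_connected: "\<And>i. i \<in> {1..m} \<Longrightarrow> path_connected_space (X i)"
    and based: "\<And>i. i \<in> {1..m} \<Longrightarrow> well_pointed (X i) (pt i)"
    and K: "simplicial_complex_on {1..m} K"
    and TC_eq_cat: "\<And>i. i \<in> {1..m} \<Longrightarrow> TC r (X i) = enat r * LS_cat (X i) (pt i)"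
    and LS_logarithmic: "\<And>S. S \<subseteq> {1..m} \<Longrightarrow> S \<noteq> {} \<Longrightarrow>
      LS_cat (product_topology X S) (restrict pt S) = (\<Sum>i\<in>S. LS_cat (X i) (pt i))"
    and TC_logarithmic: "\<And>S. S \<subseteq> {1..m} \<Longrightarrow> S \<noteq> {} \<Longrightarrow>
      TC r (product_topology X S) = (\<Sum>i\<in>S. TC r (X i))"
  shows "TC r (polyhedral_product {1..m} X pt K)
           = enat r * LS_cat (polyhedral_product {1..m} X pt K) (restrict pt {1..m})
       \<and> enat r * LS_cat (polyhedral_product {1..m} X pt K) (restrict pt {1..m})
           = Max ((\<lambda>\<sigma>. \<Sum>i\<in>\<sigma>. TC r (X i)) ` K)"
proof -
  let ?V = "{1..m}"
  let ?P = "polyhedral_product ?V X pt K"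
  let ?cat = "LS_cat ?P (restrict pt ?V)"
  let ?M = "Max ((\<lambda>\<sigma>. \<Sum>i\<in>\<sigma>. TC r (X i)) ` K)"
  have KV: "\<sigma> \<subseteq> ?V" if "\<sigma> \<in> K" for \<sigma>
    using K that by (auto simp: simplicial_complex_on_def)
  have K0: "{} \<in> K" and Kv: "\<And>v. v \<in> ?V \<Longrightarrow> {v} \<in> K"
    using K by (auto simp: simplicial_complex_on_def)
  have finK: "finite K" by (rule finite_subset[of _ "Pow ?V"]) (use KV in auto)
  have pt: "pt i \<in> topspace (X i)" if "i \<in> ?V" for i
    using based[OF that] by (simp add: well_pointed_def)
  have TC_sum: "(\<Sum>i\<in>\<sigma>. TC r (X i)) = enat r * (\<Sum>i\<in>\<sigma>. LS_cat (X i) (pt i))" if "\<sigma> \<in> K" for \<sigma>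
    unfolding sum_distrib_left using KV[OF that] TC_eq_cat by (intro sum.cong) auto
  have lower: "(\<Sum>i\<in>\<sigma>. TC r (X i)) \<le> TC r ?P \<and> (\<Sum>i\<in>\<sigma>. LS_cat (X i) (pt i)) \<le> ?cat"
    if \<sigma>: "\<sigma> \<in> K" for \<sigma>
  \<comment> \<open>The logarithmic hypotheses concern nonempty families; for the empty simplex both
    sums are 0.\<close>
  proof (cases "\<sigma> = {}")
    case False
    then show ?thesis
      using LS_cat_TC_product_le_polyhedral_product[of ?V pt X \<sigma> K, OF pt \<sigma> KV[OF \<sigma>]]
        LS_logarithmic[OF KV[OF \<sigma>]] TC_logarithmic[OF KV[OF \<sigma>]] r by (metis (no_types))
  qed simp
  have lower_TC: "?M \<le> TC r ?P"
    using finK K0 lower by (subst Max_le_iff) auto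
  have lower_cat: "?M \<le> enat r * ?cat"
    using finK K0 lower TC_sum by (subst Max_le_iff) (auto intro: mult_left_mono)
  have upper: "TC r ?P \<le> ?M \<and> enat r * ?cat \<le> ?M"
  proof (cases "?M = \<infinity>")
    case False
    have le_M: "enat r * (\<Sum>i\<in>\<sigma>. LS_cat (X i) (pt i)) \<le> ?M" if "\<sigma> \<in> K" for \<sigma>
      using finK that TC_sum[OF that, symmetric] by (auto intro: Max_ge)
    \<comment> \<open>Vertices are simplices and \<open>r\<close> is positive, so a finite maximum
      makes the category of every factor finite.\<close>
    have "LS_cat (X i) (pt i) \<noteq> \<infinity>" if "i \<in> ?V" for i
    proof
      assume "LS_cat (X i) (pt i) = \<infinity>"
      then have "enat r * LS_cat (X i) (pt i) = \<infinity>" using r by (simp add: times_enat_simps)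
      moreover have "enat r * LS_cat (X i) (pt i) \<le> ?M" using le_M[OF Kv[OF that]] by simp
      ultimately show False using False by simp
    qed
    then have "\<forall>i\<in>?V. \<exists>k. LS_cat (X i) (pt i) = enat k" by auto
    from bchoice[OF this] obtain n where n: "\<And>i. i \<in> ?V \<Longrightarrow> LS_cat (X i) (pt i) = enat (n i)"
      by blast
    define N where "N = Max (sum n ` K)"
    have N: "sum n \<sigma> \<le> N" if "\<sigma> \<in> K" for \<sigma>
      unfolding N_def using finK that by (intro Max_ge) auto
    have "N \<in> sum n ` K" unfolding N_def using finK K0 by (intro Max_in) auto
    \<comment> \<open>A simplex attaining \<open>N\<close> turns the numerical bound
      \<open>r * N\<close> into a bound by \<open>?M\<close>.\<close>
    then obtain \<tau> where \<tau>: "\<tau> \<in> K" "N = sum n \<tau>" by auto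
    have "(\<Sum>i\<in>\<tau>. LS_cat (X i) (pt i)) = (\<Sum>i\<in>\<tau>. enat (n i))"
      using KV[OF \<tau>(1)] n by (intro sum.cong) auto
    also have "\<dots> = enat N"
      unfolding \<tau>(2) by (simp flip: of_nat_eq_enat)
    finally have rN: "enat (r * N) \<le> ?M" using le_M[OF \<tau>(1)] by simp
    have "?cat \<le> enat N" "TC r ?P \<le> enat (r * N)"
      using LS_cat_TC_polyhedral_product_le[of ?V X pt n K N] normal based n KV N r by auto
    moreover from this(1) have "enat r * ?cat \<le> enat (r * N)"
      using mult_left_mono[of ?cat "enat N" "enat r"] by simp
    ultimately show ?thesis using rN by (meson order_trans)
  qed simp
  from upper lower_TC lower_cat show ?thesis by (metis order_antisym)
qed

end
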